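(* Let $R$ be a commutative ring. There is a bijective correspondence between Thomason subsets $X$ of $\mathrm{Spec}(R)$ and compatible families $\{X(\mathfrak{m})\mid\mathfrak{m}\in\mathrm{mSpec}(R)\}$ of Thomason subsets (with $X(\mathfrak{m})\subseteq\mathrm{Spec}(R_\mathfrak{m})$), induced by the mutually inverse assignments $$X\mapsto X(\mathfrak{m})=X_\mathfrak{m}=\{\mathfrak{p}_\mathfrak{m}\mid\mathfrak{p}\in X,\ \mathfrak{p}\subseteq\mathfrak{m}\}\quad\forall\mathfrak{m}\in\mathrm{mSpec}(R)$$ and $$\{X(\mathfrak{m})\mid\mathfrak{m}\in\mathrm{mSpec}(R)\}\mapsto X=\bigcup_{\mathfrak{m}\in\mathrm{mSpec}(R)}X(\mathfrak{m})^*.$$ Applying these assignments in each degree $n\in\mathbb{Z}$, this bijection extends to a bijection between Thomason filtrations $\mathbb{X}$ of $\mathrm{Spec}(R)$ and compatible families $\{\mathbb{X}(\mathfrak{m})\mid\mathfrak{m}\in\mathrm{mSpec}(R)\}$ of Thomason filtrations (with $\mathbb{X}(\mathfrak{m})$ a Thomason filtration of $\mathrm{Spec}(R_\mathfrak{m})$).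
   Context: $\mathrm{mSpec}(R)$ is the set of maximal ideals of $R$. A subset of $\mathrm{Spec}(R)$ is Thomason if it is a union of sets $V(I)$ with $I$ ranging over a set of finitely generated ideals. A Thomason filtration is a sequence $\mathbb{X}=(X_n\mid n\in\mathbb{Z})$ of Thomason subsets with $X_n\supseteq X_{n+1}$ for each $n$. For $Y\subseteq\mathrm{Spec}(R_\mathfrak{m})$, $Y^*$ denotes its image under the natural inclusion $\mathrm{Spec}(R_\mathfrak{m})\hookrightarrow\mathrm{Spec}(R)$; $\mathfrak{p}_\mathfrak{m}=\mathfrak{p}R_\mathfrak{m}$. A family of Thomason subsets $X(\mathfrak{m})\subseteq\mathrm{Spec}(R_\mathfrak{m})$, $\mathfrak{m}\in\mathrm{mSpec}(R)$, is compatible if (1) $\{\mathfrak{p}\in X(\mathfrak{m})^*\mid\mathfrak{p}\subseteq\mathfrak{m}'\}=\{\mathfrak{p}\in X(\mathfrak{m}')^*\mid\mathfrak{p}\subseteq\mathfrak{m}\}$ for all $\mathfrak{m},\mathfrak{m}'\in\mathrm{mSpec}(R)$, and (2) $\bigcup_\mathfrak{m}X(\mathfrak{m})^*$ is a Thomason subset of $\mathrm{Spec}(R)$. A family of Thomason filtrations $\mathbb{X}(\mathfrak{m})=(X(\mathfrak{m})_n\mid n\in\mathbb{Z})$ of $\mathrm{Spec}(R_\mathfrak{m})$ is compatible if $\{X(\mathfrak{m})_n\mid\mathfrak{m}\in\mathrm{mSpec}(R)\}$ is compatible for every $n\in\mathbb{Z}$. *)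

theory Defs
  imports "HOL-Algebra.RingHom"
begin

section \<open>Localization of a commutative ring\<close>

definition fraction_rel :: "('a, 'b) ring_scheme \<Rightarrow> 'a set \<Rightarrow> (('a \<times> 'a) \<times> ('a \<times> 'a)) set" where
  "fraction_rel R S =
     {((a, s), (b, t)). a \<in> carrier R \<and> s \<in> S \<and> b \<in> carrier R \<and> t \<in> S \<and>
        (\<exists>u\<in>S. u \<otimes>\<^bsub>R\<^esub> (a \<otimes>\<^bsub>R\<^esub> t) = u \<otimes>\<^bsub>R\<^esub> (b \<otimes>\<^bsub>R\<^esub> s))}"

definition fraction :: "('a, 'b) ring_scheme \<Rightarrow> 'a set \<Rightarrow> 'a \<Rightarrow> 'a \<Rightarrow> ('a \<times> 'a) set" where
  "fraction R S a s = fraction_rel R S `` {(a, s)}"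

text \<open>The unions below range over all representatives of the two arguments; all of them contribute
  the same fraction (lemmas \<open>fraction_add\<close>, \<open>fraction_mult\<close>).\<close>

definition localization :: "('a, 'b) ring_scheme \<Rightarrow> 'a set \<Rightarrow> ('a \<times> 'a) set ring" where
  "localization R S =
     \<lparr> carrier = (carrier R \<times> S) // fraction_rel R S,
       mult = (\<lambda>x y. \<Union>(a, s)\<in>x. \<Union>(b, t)\<in>y. fraction R S (a \<otimes>\<^bsub>R\<^esub> b) (s \<otimes>\<^bsub>R\<^esub> t)),
       one = fraction R S \<one>\<^bsub>R\<^esub> \<one>\<^bsub>R\<^esub>,
       zero = fraction R S \<zero>\<^bsub>R\<^esub> \<one>\<^bsub>R\<^esub>,
       add = (\<lambda>x y. \<Union>(a, s)\<in>x. \<Union>(b, t)\<in>y.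
                fraction R S (a \<otimes>\<^bsub>R\<^esub> t \<oplus>\<^bsub>R\<^esub> b \<otimes>\<^bsub>R\<^esub> s) (s \<otimes>\<^bsub>R\<^esub> t)) \<rparr>"

definition to_localization :: "('a, 'b) ring_scheme \<Rightarrow> 'a set \<Rightarrow> 'a \<Rightarrow> ('a \<times> 'a) set" where
  "to_localization R S a = fraction R S a \<one>\<^bsub>R\<^esub>"

locale mult_subset = cring R for R (structure) +
  fixes S
  assumes S_sub: "S \<subseteq> carrier R"
    and S_one: "\<one> \<in> S"
    and S_mult: "\<lbrakk> s \<in> S; t \<in> S \<rbrakk> \<Longrightarrow> s \<otimes> t \<in> S"
begin

lemma S_carr [simp, intro]: "s \<in> S \<Longrightarrow> s \<in> carrier R"
  using S_sub by blast

lemma fraction_rel_iff: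
  "((a, s), (b, t)) \<in> fraction_rel R S \<longleftrightarrow>
     a \<in> carrier R \<and> s \<in> S \<and> b \<in> carrier R \<and> t \<in> S \<and> (\<exists>u\<in>S. u \<otimes> (a \<otimes> t) = u \<otimes> (b \<otimes> s))"
  by (simp add: fraction_rel_def)

lemma equiv_fraction_rel: "equiv (carrier R \<times> S) (fraction_rel R S)"
proof (rule equivI)
  show "fraction_rel R S \<subseteq> (carrier R \<times> S) \<times> (carrier R \<times> S)"
    by (auto simp: fraction_rel_def)
  show "refl_on (carrier R \<times> S) (fraction_rel R S)"
    using S_one by (auto simp: refl_on_def fraction_rel_def)
  show "sym (fraction_rel R S)"
    by (rule symI) (force simp: fraction_rel_def)
  show "trans (fraction_rel R S)"
  proof (rule transI, clarify)
    fix a s b t c r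
    assume "((a, s), (b, t)) \<in> fraction_rel R S" "((b, t), (c, r)) \<in> fraction_rel R S"
    then obtain u v where mem: "a \<in> carrier R" "s \<in> S" "b \<in> carrier R" "t \<in> S" "c \<in> carrier R" "r \<in> S"
      and u: "u \<in> S" "u \<otimes> (a \<otimes> t) = u \<otimes> (b \<otimes> s)"
      and v: "v \<in> S" "v \<otimes> (b \<otimes> r) = v \<otimes> (c \<otimes> t)"
      unfolding fraction_rel_iff by blast
    have "(u \<otimes> v \<otimes> t) \<otimes> (a \<otimes> r) = (u \<otimes> (a \<otimes> t)) \<otimes> (v \<otimes> r)"
      using mem u(1) v(1) by (simp add: m_ac)
    also have "\<dots> = (u \<otimes> s) \<otimes> (v \<otimes> (b \<otimes> r))"
      unfolding u(2) using mem u(1) v(1) by (simp add: m_ac)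
    also have "\<dots> = (u \<otimes> v \<otimes> t) \<otimes> (c \<otimes> s)"
      unfolding v(2) using mem u(1) v(1) by (simp add: m_ac)
    finally show "((a, s), (c, r)) \<in> fraction_rel R S"
      unfolding fraction_rel_iff using mem u(1) v(1) S_mult by blast
  qed
qed

lemma fraction_eq_iff:
  assumes "a \<in> carrier R" "s \<in> S" "b \<in> carrier R" "t \<in> S"
  shows "fraction R S a s = fraction R S b t \<longleftrightarrow> (\<exists>u\<in>S. u \<otimes> (a \<otimes> t) = u \<otimes> (b \<otimes> s))"
  unfolding fraction_def
  using eq_equiv_class_iff[OF equiv_fraction_rel, of "(a, s)" "(b, t)"] assms
  by (simp add: fraction_rel_iff)

lemma fraction_eqI:
  assumes "a \<in> carrier R" "s \<in> S" "b \<in> carrier R" "t \<in> S" "a \<otimes> t = b \<otimes> s"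
  shows "fraction R S a s = fraction R S b t"
  using assms S_one by (auto simp: fraction_eq_iff)

lemma carrier_localization:
  "carrier (localization R S) = {fraction R S a s |a s. a \<in> carrier R \<and> s \<in> S}"
  by (auto simp: localization_def quotient_def fraction_def)

lemma fraction_closed [simp, intro]:
  "\<lbrakk> a \<in> carrier R; s \<in> S \<rbrakk> \<Longrightarrow> fraction R S a s \<in> carrier (localization R S)"
  by (auto simp: carrier_localization)

lemma fractionE [elim?]:
  assumes "x \<in> carrier (localization R S)"
  obtains a s where "x = fraction R S a s" "a \<in> carrier R" "s \<in> S"
  using assms by (auto simp: carrier_localization)

lemma fraction_mult:
  assumes "a \<in> carrier R" "s \<in> S" "b \<in> carrier R" "t \<in> S"
  shows "fraction R S a s \<otimes>\<^bsub>localization R S\<^esub> fraction R S b t = fraction R S (a \<otimes> b) (s \<otimes> t)"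
proof -
  have "congruent2 (fraction_rel R S) (fraction_rel R S)
          (\<lambda>(a, s) (b, t). fraction R S (a \<otimes> b) (s \<otimes> t))"
  proof (rule congruent2I[OF equiv_fraction_rel equiv_fraction_rel], goal_cases)
    case (1 y z w)
    obtain a s b t c r where yz: "y = (a, s)" "z = (b, t)" "w = (c, r)"
      by (metis surj_pair)
    from 1 obtain u where mem: "a \<in> carrier R" "s \<in> S" "b \<in> carrier R" "t \<in> S" "c \<in> carrier R" "r \<in> S"
      and u: "u \<in> S" "u \<otimes> (a \<otimes> t) = u \<otimes> (b \<otimes> s)"
      unfolding yz fraction_rel_iff by auto
    have "u \<otimes> ((a \<otimes> c) \<otimes> (t \<otimes> r)) = (u \<otimes> (a \<otimes> t)) \<otimes> (c \<otimes> r)"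
      using mem u(1) by (simp add: m_ac)
    also have "\<dots> = u \<otimes> ((b \<otimes> c) \<otimes> (s \<otimes> r))"
      unfolding u(2) using mem u(1) by (simp add: m_ac)
    finally show ?case
      using mem u(1) S_mult by (auto simp: yz fraction_eq_iff)
  next
    case (2 y z w)
    obtain a s b t c r where yz: "y = (a, s)" "z = (b, t)" "w = (c, r)"
      by (metis surj_pair)
    from 2 obtain u where mem: "a \<in> carrier R" "s \<in> S" "b \<in> carrier R" "t \<in> S" "c \<in> carrier R" "r \<in> S"
      and u: "u \<in> S" "u \<otimes> (a \<otimes> t) = u \<otimes> (b \<otimes> s)"
      unfolding yz fraction_rel_iff by auto
    have "u \<otimes> ((c \<otimes> a) \<otimes> (r \<otimes> t)) = (u \<otimes> (a \<otimes> t)) \<otimes> (c \<otimes> r)"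
      using mem u(1) by (simp add: m_ac)
    also have "\<dots> = u \<otimes> ((c \<otimes> b) \<otimes> (r \<otimes> s))"
      unfolding u(2) using mem u(1) by (simp add: m_ac)
    finally show ?case
      using mem u(1) S_mult by (auto simp: yz fraction_eq_iff)
  qed
  from UN_equiv_class2[OF equiv_fraction_rel equiv_fraction_rel this, of "(a, s)" "(b, t)"] assms
  show ?thesis
    by (simp add: localization_def fraction_def[of R S a s] fraction_def[of R S b t] case_prod_unfold)
qed

lemma fraction_add:
  assumes "a \<in> carrier R" "s \<in> S" "b \<in> carrier R" "t \<in> S"
  shows "fraction R S a s \<oplus>\<^bsub>localization R S\<^esub> fraction R S b t
           = fraction R S (a \<otimes> t \<oplus> b \<otimes> s) (s \<otimes> t)"
proof -
  have "congruent2 (fraction_rel R S) (fraction_rel R S)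
          (\<lambda>(a, s) (b, t). fraction R S (a \<otimes> t \<oplus> b \<otimes> s) (s \<otimes> t))"
  proof (rule congruent2I[OF equiv_fraction_rel equiv_fraction_rel], goal_cases)
    case (1 y z w)
    obtain a s b t c r where yz: "y = (a, s)" "z = (b, t)" "w = (c, r)"
      by (metis surj_pair)
    from 1 obtain u where mem: "a \<in> carrier R" "s \<in> S" "b \<in> carrier R" "t \<in> S" "c \<in> carrier R" "r \<in> S"
      and u: "u \<in> S" "u \<otimes> (a \<otimes> t) = u \<otimes> (b \<otimes> s)"
      unfolding yz fraction_rel_iff by auto
    have "u \<otimes> ((a \<otimes> r \<oplus> c \<otimes> s) \<otimes> (t \<otimes> r))
            = (u \<otimes> (a \<otimes> t)) \<otimes> (r \<otimes> r) \<oplus> u \<otimes> (c \<otimes> s \<otimes> (t \<otimes> r))"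
      using mem u(1) by (simp add: m_ac l_distr r_distr)
    also have "\<dots> = u \<otimes> ((b \<otimes> r \<oplus> c \<otimes> t) \<otimes> (s \<otimes> r))"
      unfolding u(2) using mem u(1) by (simp add: m_ac l_distr r_distr)
    finally show ?case
      using mem u(1) S_mult by (auto simp: yz fraction_eq_iff)
  next
    case (2 y z w)
    obtain a s b t c r where yz: "y = (a, s)" "z = (b, t)" "w = (c, r)"
      by (metis surj_pair)
    from 2 obtain u where mem: "a \<in> carrier R" "s \<in> S" "b \<in> carrier R" "t \<in> S" "c \<in> carrier R" "r \<in> S"
      and u: "u \<in> S" "u \<otimes> (a \<otimes> t) = u \<otimes> (b \<otimes> s)"
      unfolding yz fraction_rel_iff by auto
    have "u \<otimes> ((c \<otimes> s \<oplus> a \<otimes> r) \<otimes> (r \<otimes> t))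
            = u \<otimes> (c \<otimes> s \<otimes> (r \<otimes> t)) \<oplus> (u \<otimes> (a \<otimes> t)) \<otimes> (r \<otimes> r)"
      using mem u(1) by (simp add: m_ac l_distr r_distr)
    also have "\<dots> = u \<otimes> ((c \<otimes> t \<oplus> b \<otimes> r) \<otimes> (r \<otimes> s))"
      unfolding u(2) using mem u(1) by (simp add: m_ac l_distr r_distr)
    finally show ?case
      using mem u(1) S_mult by (auto simp: yz fraction_eq_iff)
  qed
  from UN_equiv_class2[OF equiv_fraction_rel equiv_fraction_rel this, of "(a, s)" "(b, t)"] assms
  show ?thesis
    by (simp add: localization_def fraction_def[of R S a s] fraction_def[of R S b t] case_prod_unfold)
qed

lemma one_localization: "\<one>\<^bsub>localization R S\<^esub> = fraction R S \<one> \<one>"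
  and zero_localization: "\<zero>\<^bsub>localization R S\<^esub> = fraction R S \<zero> \<one>"
  by (simp_all add: localization_def)

lemmas localization_simps =
  fraction_mult fraction_add one_localization zero_localization

lemma cring_localization: "cring (localization R S)"
proof (rule cringI)
  show "abelian_group (localization R S)"
  proof (rule abelian_groupI)
    fix x assume "x \<in> carrier (localization R S)"
    then obtain a s where x: "x = fraction R S a s" "a \<in> carrier R" "s \<in> S"
      by (rule fractionE)
    have "fraction R S (\<ominus> a) s \<oplus>\<^bsub>localization R S\<^esub> x = \<zero>\<^bsub>localization R S\<^esub>"
      using x S_one S_mult
      by (simp add: fraction_add zero_localization l_minus l_neg)
         (rule fraction_eqI, auto)
    with x show "\<exists>y\<in>carrier (localization R S). y \<oplus>\<^bsub>localization R S\<^esub> x = \<zero>\<^bsub>localization R S\<^esub>"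
      by blast
  qed (use S_one S_mult in
        \<open>auto elim!: fractionE simp: localization_simps l_distr r_distr m_ac a_ac intro!: fraction_eqI\<close>)
  show "comm_monoid (localization R S)"
    by (rule comm_monoidI)
       (use S_one S_mult in \<open>auto elim!: fractionE simp: localization_simps m_ac intro!: fraction_eqI\<close>)
  fix x y z
  assume "x \<in> carrier (localization R S)" "y \<in> carrier (localization R S)"
    "z \<in> carrier (localization R S)"
  then show "(x \<oplus>\<^bsub>localization R S\<^esub> y) \<otimes>\<^bsub>localization R S\<^esub> z
      = x \<otimes>\<^bsub>localization R S\<^esub> z \<oplus>\<^bsub>localization R S\<^esub> y \<otimes>\<^bsub>localization R S\<^esub> z"
    using S_one S_mult
    by (elim fractionE, simp add: localization_simps, intro fraction_eqI)
       (auto simp: l_distr r_distr m_ac)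
qed

lemma to_localization_hom: "to_localization R S \<in> ring_hom R (localization R S)"
  using S_one
  by (auto intro!: ring_hom_memI simp: to_localization_def fraction_mult fraction_add one_localization)

end

lemma mult_subset_compl_prime:
  assumes "primeideal P R"
  shows "mult_subset R (carrier R - P)"
proof -
  interpret primeideal P R by fact
  show ?thesis
  proof
    show "\<one>\<^bsub>R\<^esub> \<in> carrier R - P"
      using I_notcarr one_imp_carrier by auto
    show "s \<otimes>\<^bsub>R\<^esub> t \<in> carrier R - P" if "s \<in> carrier R - P" "t \<in> carrier R - P" for s t
      using that I_prime by auto
  qed auto
qed


section \<open>Spectra and Thomason subsets\<close>

definition Spec :: "('a, 'b) ring_scheme \<Rightarrow> 'a set set" where
  "Spec R = {P. primeideal P R}"

definition mSpec :: "('a, 'b) ring_scheme \<Rightarrow> 'a set set" where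
  "mSpec R = {M. maximalideal M R}"

definition V :: "('a, 'b) ring_scheme \<Rightarrow> 'a set \<Rightarrow> 'a set set" where
  "V R I = {P \<in> Spec R. I \<subseteq> P}"

definition fg_ideal :: "('a, 'b) ring_scheme \<Rightarrow> 'a set \<Rightarrow> bool" where
  "fg_ideal R I \<longleftrightarrow> (\<exists>A. finite A \<and> A \<subseteq> carrier R \<and> I = Idl\<^bsub>R\<^esub> A)"

definition thomason_subset :: "('a, 'b) ring_scheme \<Rightarrow> 'a set set \<Rightarrow> bool" where
  "thomason_subset R X \<longleftrightarrow> (\<exists>\<I>. (\<forall>I\<in>\<I>. fg_ideal R I) \<and> X = (\<Union>I\<in>\<I>. V R I))"

definition thomason_filtration :: "('a, 'b) ring_scheme \<Rightarrow> (int \<Rightarrow> 'a set set) \<Rightarrow> bool" where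
  "thomason_filtration R X \<longleftrightarrow> (\<forall>n. thomason_subset R (X n)) \<and> (\<forall>n. X (n + 1) \<subseteq> X n)"


section \<open>Localization at a prime and compatible families\<close>

definition local_ring :: "('a, 'b) ring_scheme \<Rightarrow> 'a set \<Rightarrow> ('a \<times> 'a) set ring" where
  "local_ring R P = localization R (carrier R - P)"

definition to_local_ring :: "('a, 'b) ring_scheme \<Rightarrow> 'a set \<Rightarrow> 'a \<Rightarrow> ('a \<times> 'a) set" where
  "to_local_ring R P = to_localization R (carrier R - P)"

text \<open>\<open>extend_ideal R M P\<close> is \<open>P R\<^sub>M\<close>.\<close>

definition extend_ideal :: "('a, 'b) ring_scheme \<Rightarrow> 'a set \<Rightarrow> 'a set \<Rightarrow> ('a \<times> 'a) set set" where
  "extend_ideal R M P = Idl\<^bsub>local_ring R M\<^esub> (to_local_ring R M ` P)"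

text \<open>The map \<open>Spec R\<^sub>M \<rightarrow> Spec R\<close> induced by the canonical homomorphism \<open>R \<rightarrow> R\<^sub>M\<close>.\<close>

definition spec_incl :: "('a, 'b) ring_scheme \<Rightarrow> 'a set \<Rightarrow> ('a \<times> 'a) set set \<Rightarrow> 'a set" where
  "spec_incl R M Q = {a \<in> carrier R. to_local_ring R M a \<in> Q}"

text \<open>\<open>star R M Y\<close> is \<open>Y\<^sup>*\<close> for \<open>Y \<subseteq> Spec R\<^sub>M\<close>.\<close>

definition star :: "('a, 'b) ring_scheme \<Rightarrow> 'a set \<Rightarrow> ('a \<times> 'a) set set set \<Rightarrow> 'a set set" where
  "star R M Y = spec_incl R M ` Y"

definition compatible ::
    "('a, 'b) ring_scheme \<Rightarrow> ('a set \<Rightarrow> ('a \<times> 'a) set set set) \<Rightarrow> bool" where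
  "compatible R F \<longleftrightarrow>
     (\<forall>M\<in>mSpec R. \<forall>M'\<in>mSpec R.
        {P \<in> star R M (F M). P \<subseteq> M'} = {P \<in> star R M' (F M'). P \<subseteq> M}) \<and>
     thomason_subset R (\<Union>M\<in>mSpec R. star R M (F M))"

text \<open>Families indexed by \<open>mSpec R\<close> are functions that are \<^const>\<open>undefined\<close> outside of
  \<open>mSpec R\<close>, so that equality of functions is equality of families.\<close>

definition compatible_families :: "('a, 'b) ring_scheme \<Rightarrow> ('a set \<Rightarrow> ('a \<times> 'a) set set set) set" where
  "compatible_families R =
     {F \<in> (\<Pi>\<^sub>E M\<in>mSpec R. {Y. thomason_subset (local_ring R M) Y}). compatible R F}"

definition compatible_filtration_families ::
    "('a, 'b) ring_scheme \<Rightarrow> ('a set \<Rightarrow> int \<Rightarrow> ('a \<times> 'a) set set set) set" where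
  "compatible_filtration_families R =
     {F \<in> (\<Pi>\<^sub>E M\<in>mSpec R. {Y. thomason_filtration (local_ring R M) Y}).
        \<forall>n. compatible R (\<lambda>M. F M n)}"

definition localize_subset ::
    "('a, 'b) ring_scheme \<Rightarrow> 'a set set \<Rightarrow> 'a set \<Rightarrow> ('a \<times> 'a) set set set" where
  "localize_subset R X = (\<lambda>M\<in>mSpec R. {extend_ideal R M P |P. P \<in> X \<and> P \<subseteq> M})"

definition glue ::
    "('a, 'b) ring_scheme \<Rightarrow> ('a set \<Rightarrow> ('a \<times> 'a) set set set) \<Rightarrow> 'a set set" where
  "glue R F = (\<Union>M\<in>mSpec R. star R M (F M))"

definition localize_filtration ::
    "('a, 'b) ring_scheme \<Rightarrow> (int \<Rightarrow> 'a set set) \<Rightarrow> 'a set \<Rightarrow> int \<Rightarrow> ('a \<times> 'a) set set set" where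
  "localize_filtration R X = (\<lambda>M\<in>mSpec R. \<lambda>n. localize_subset R (X n) M)"

definition glue_filtration ::
    "('a, 'b) ring_scheme \<Rightarrow> ('a set \<Rightarrow> int \<Rightarrow> ('a \<times> 'a) set set set) \<Rightarrow> int \<Rightarrow> 'a set set" where
  "glue_filtration R F = (\<lambda>n. glue R (\<lambda>M. F M n))"

end

theory Submission
  imports Defs "HOL-Algebra.QuotRing"
begin

text \<open>Contraction along \<open>R \<rightarrow> R\<^sub>M\<close> is a bijection from \<open>Spec R\<^sub>M\<close> onto the primes of \<open>R\<close> contained in
  \<open>M\<close>, with inverse \<open>P \<mapsto> P R\<^sub>M\<close>, and it turns \<open>V\<close> of the ideal generated by the image of \<open>A\<close> into
  the part below \<open>M\<close> of \<open>V\<close> of the ideal generated by \<open>A\<close>. Hence \<open>X\<^sub>M\<close> is again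
  Thomason, and the sets \<open>X\<^sub>M\<^sup>* = {P \<in> X. P \<subseteq> M}\<close> cover \<open>X\<close> because each prime lies in a maximal
  ideal. Conversely, condition (1) of compatibility says that gluing adds no prime below \<open>M\<close> to
  those already in \<open>X(M)\<^sup>*\<close>.\<close>

section \<open>Maximal ideals above a given prime\<close>

text \<open>Zorn's lemma applies because properness of an ideal amounts to
  \<open>\<one> \<notin> J\<close>, a condition that survives unions of chains.\<close>

lemma (in cring) exists_maximalideal:
  assumes "ideal I R" "I \<noteq> carrier R"
  obtains M where "maximalideal M R" "I \<subseteq> M"
proof -
  let ?A = "{J. ideal J R \<and> I \<subseteq> J \<and> \<one> \<notin> J}"
  have proper: "J \<noteq> carrier R \<longleftrightarrow> \<one> \<notin> J" if "ideal J R" for J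
    using ideal.one_imp_carrier[OF that] by auto
  have "\<exists>M\<in>?A. \<forall>J\<in>?A. M \<subseteq> J \<longrightarrow> J = M"
  proof (rule subset_Zorn_nonempty)
    show "?A \<noteq> {}"
      using assms proper by blast
    fix C assume C: "C \<noteq> {}" "subset.chain ?A C"
    then have mem: "\<And>J. J \<in> C \<Longrightarrow> ideal J R \<and> I \<subseteq> J \<and> \<one> \<notin> J"
      and total: "\<And>J K. \<lbrakk>J \<in> C; K \<in> C\<rbrakk> \<Longrightarrow> J \<subseteq> K \<or> K \<subseteq> J"
      by (auto simp: subset_chain_def)
    have "ideal (\<Union>C) R"
    proof (rule idealI[OF ring_axioms add.subgroupI])
      show "\<Union>C \<subseteq> carrier R"
        using mem ideal.Icarr by fastforce
      show "\<Union>C \<noteq> {}"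
        using C(1) mem additive_subgroup.zero_closed[OF ideal.axioms(1)] by fastforce
      show "\<ominus> a \<in> \<Union>C" if "a \<in> \<Union>C" for a
        using that mem additive_subgroup.a_inv_closed[OF ideal.axioms(1)] by fastforce
      show "a \<oplus> b \<in> \<Union>C" if ab: "a \<in> \<Union>C" "b \<in> \<Union>C" for a b
      proof -
        \<comment> \<open>Of the two members of the chain that contain \<open>a\<close> and
          \<open>b\<close>, the larger contains both.\<close>
        obtain J where "J \<in> C" "a \<in> J" "b \<in> J"
          using ab total by blast
        then show ?thesis
          using mem additive_subgroup.a_closed[OF ideal.axioms(1)] by fast
      qed
      show "x \<otimes> a \<in> \<Union>C" "a \<otimes> x \<in> \<Union>C" if "a \<in> \<Union>C" "x \<in> carrier R" for a x
        using that mem ideal.I_l_closed ideal.I_r_closed by fast+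
    qed
    then show "\<Union>C \<in> ?A"
      using C(1) mem by blast
  qed
  then obtain M where M: "ideal M R" "I \<subseteq> M" "\<one> \<notin> M"
    and max: "\<And>J. \<lbrakk>ideal J R; M \<subseteq> J; \<one> \<notin> J\<rbrakk> \<Longrightarrow> J = M"
    by auto
  have "maximalideal M R"
  proof (rule maximalidealI[OF M(1)])
    show "carrier R \<noteq> M"
      using M(3) by auto
    show "J = M \<or> J = carrier R" if "ideal J R" "M \<subseteq> J" for J
      using max[OF that] proper[OF that(1)] by blast
  qed
  with M(2) show thesis
    using that by blast
qed

lemma (in cring) mSpec_subset_Spec: "mSpec R \<subseteq> Spec R"
  using maximalideal_prime by (auto simp: mSpec_def Spec_def)

lemma (in cring) Spec_below_mSpec:
  assumes "P \<in> Spec R"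
  obtains M where "M \<in> mSpec R" "P \<subseteq> M"
proof -
  interpret primeideal P R
    using assms by (simp add: Spec_def)
  show thesis
    using exists_maximalideal[OF is_ideal] I_notcarr that by (auto simp: mSpec_def)
qed

section \<open>Thomason subsets in terms of finite sets of elements\<close>

lemma thomason_subset_Spec: "thomason_subset R X \<Longrightarrow> X \<subseteq> Spec R"
  by (auto simp: thomason_subset_def V_def)

lemma (in ring) V_genideal:
  assumes "A \<subseteq> carrier R"
  shows "V R (Idl A) = {P \<in> Spec R. A \<subseteq> P}"
  using Idl_subset_ideal[OF primeideal.axioms(1) assms] by (auto simp: V_def Spec_def)

text \<open>A prime contains an ideal as soon as it contains its generators, so finite sets can
  replace finitely generated ideals. In this form a Thomason subset passes to a localization by
  taking images of finite sets.\<close>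

lemma (in ring) thomason_subset_iff:
  "thomason_subset R X \<longleftrightarrow>
     (\<exists>\<A>. (\<forall>A\<in>\<A>. finite A \<and> A \<subseteq> carrier R) \<and> X = {P \<in> Spec R. \<exists>A\<in>\<A>. A \<subseteq> P})"
  (is "_ \<longleftrightarrow> (\<exists>\<A>. ?fin \<A> \<and> X = ?D \<A>)")
proof
  assume "thomason_subset R X"
  then obtain \<I> where I: "\<forall>I\<in>\<I>. fg_ideal R I" "X = (\<Union>I\<in>\<I>. V R I)"
    by (auto simp: thomason_subset_def)
  \<comment> \<open>All finite generating sets of members of \<open>\<I>\<close> are taken at once,
    which avoids choosing one for each ideal.\<close>
  let ?A = "{A. finite A \<and> A \<subseteq> carrier R \<and> Idl A \<in> \<I>}"
  have "X = (\<Union>A\<in>?A. V R (Idl A))"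
    using I by (fastforce simp: fg_ideal_def)
  also have "\<dots> = (\<Union>A\<in>?A. {P \<in> Spec R. A \<subseteq> P})"
    by (rule SUP_cong) (simp_all add: V_genideal)
  also have "\<dots> = ?D ?A"
    by blast
  finally have "X = ?D ?A" .
  then show "\<exists>\<A>. ?fin \<A> \<and> X = ?D \<A>"
    by (intro exI[of _ ?A]) simp
next
  assume "\<exists>\<A>. ?fin \<A> \<and> X = ?D \<A>"
  then obtain \<A> where A: "?fin \<A>" "X = ?D \<A>"
    by blast
  have "X = (\<Union>A\<in>\<A>. {P \<in> Spec R. A \<subseteq> P})"
    using A(2) by blast
  also have "\<dots> = (\<Union>A\<in>\<A>. V R (Idl A))"
    using A(1) by (intro SUP_cong) (simp_all add: V_genideal)
  finally have "X = (\<Union>I\<in>(\<lambda>A. Idl A) ` \<A>. V R I)"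
    by simp
  moreover have "\<forall>I\<in>(\<lambda>A. Idl A) ` \<A>. fg_ideal R I"
    using A(1) by (auto simp: fg_ideal_def)
  ultimately show "thomason_subset R X"
    unfolding thomason_subset_def by blast
qed

section \<open>Prime ideals of a localization\<close>

context mult_subset
begin

lemma ring_hom_ring_to_localization:
  "ring_hom_ring R (localization R S) (to_localization R S)"
  by (intro ring_hom_ringI2 ring_axioms cring.axioms(1)[OF cring_localization] to_localization_hom)

lemma fraction_eq_mult:
  assumes "a \<in> carrier R" "s \<in> S"
  shows "fraction R S a s = fraction R S \<one> s \<otimes>\<^bsub>localization R S\<^esub> to_localization R S a"
  using assms S_one by (simp add: to_localization_def fraction_mult)

lemma to_localization_eq_mult:
  assumes "a \<in> carrier R" "s \<in> S"
  shows "to_localization R S a = to_localization R S s \<otimes>\<^bsub>localization R S\<^esub> fraction R S a s"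
proof -
  have "fraction R S a \<one> = fraction R S (s \<otimes> a) s"
    using assms S_one by (intro fraction_eqI) (simp_all add: m_comm)
  then show ?thesis
    using assms S_one by (simp add: to_localization_def fraction_mult)
qed

text \<open>Since \<open>s/1\<close> is a unit, \<open>a/s\<close> and \<open>a/1\<close> are
  multiples of each other. Membership in an ideal of the localization therefore depends on
  numerators only.\<close>

lemma fraction_mem_ideal_iff:
  assumes "ideal Q (localization R S)" "a \<in> carrier R" "s \<in> S"
  shows "fraction R S a s \<in> Q \<longleftrightarrow> to_localization R S a \<in> Q"
proof -
  interpret ideal Q "localization R S" by fact
  show ?thesis
    using I_l_closed[of "fraction R S a s" "to_localization R S s"]
      I_l_closed[of "to_localization R S a" "fraction R S \<one> s"]
      fraction_eq_mult[OF assms(2,3)] to_localization_eq_mult[OF assms(2,3)] assms(3) S_one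
    by (auto simp: to_localization_def)
qed

text \<open>Membership does not depend on the representative: \<open>a/s = b/t\<close> gives
  \<open>u a t = u b s\<close> with the right side in \<open>P\<close>, and primeness cancels
  \<open>u\<close> and \<open>t\<close>, which lie outside \<open>P\<close>.\<close>

lemma fraction_mem_primeideal:
  assumes "primeideal P R" "P \<inter> S = {}" "a \<in> carrier R" "s \<in> S"
  shows "fraction R S a s \<in> {fraction R S b t |b t. b \<in> P \<and> t \<in> S} \<longleftrightarrow> a \<in> P"
proof
  interpret P: primeideal P R by fact
  assume "fraction R S a s \<in> {fraction R S b t |b t. b \<in> P \<and> t \<in> S}"
  then obtain b t where bt: "b \<in> P" "t \<in> S" "fraction R S a s = fraction R S b t"
    by blast
  then obtain u where u: "u \<in> S" "u \<otimes> (a \<otimes> t) = u \<otimes> (b \<otimes> s)"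
    using assms by (auto simp: fraction_eq_iff)
  have "u \<otimes> (a \<otimes> t) \<in> P"
    unfolding u(2) using bt u(1) assms by (simp add: P.I_l_closed P.I_r_closed)
  then show "a \<in> P"
    using P.I_prime[of u "a \<otimes> t"] P.I_prime[of a t] assms u(1) bt(2) by auto
qed (use assms in blast)

text \<open>The fractions with numerator in \<open>P\<close> already form an ideal, and any ideal
  containing the image of \<open>P\<close> contains them. Primeness can then be tested on
  numerators, where it is that of \<open>P\<close>.\<close>

lemma genideal_image_primeideal:
  assumes "primeideal P R" "P \<inter> S = {}"
  shows "Idl\<^bsub>localization R S\<^esub> (to_localization R S ` P) = {fraction R S a s |a s. a \<in> P \<and> s \<in> S}"
    (is "_ = ?E")
    and "primeideal (Idl\<^bsub>localization R S\<^esub> (to_localization R S ` P)) (localization R S)"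
proof -
  interpret P: primeideal P R by fact
  interpret L: cring "localization R S" by (rule cring_localization)
  have closed: "x \<otimes>\<^bsub>localization R S\<^esub> y \<in> ?E" if x: "x \<in> carrier (localization R S)" and y: "y \<in> ?E" for x y
  proof -
    obtain a s where "x = fraction R S a s" "a \<in> carrier R" "s \<in> S"
      using x by (rule fractionE)
    moreover obtain b t where "y = fraction R S b t" "b \<in> P" "t \<in> S"
      using y by blast
    ultimately have "x \<otimes>\<^bsub>localization R S\<^esub> y = fraction R S (a \<otimes> b) (s \<otimes> t)"
      "a \<otimes> b \<in> P" "s \<otimes> t \<in> S"
      by (simp_all add: fraction_mult P.I_l_closed S_mult)
    then show ?thesis
      by blast
  qed
  have E_sub: "?E \<subseteq> carrier (localization R S)"
    by auto
  have E: "ideal ?E (localization R S)"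
  proof (rule idealI[OF L.ring_axioms L.add.subgroupI])
    show "?E \<noteq> {}"
      using P.zero_closed S_one by blast
    show "\<ominus>\<^bsub>localization R S\<^esub> x \<in> ?E" if x: "x \<in> ?E" for x
    proof -
      \<comment> \<open>Negation is multiplication by minus one, so \<open>closed\<close> covers
        it.\<close>
      have "\<ominus>\<^bsub>localization R S\<^esub> x = \<ominus>\<^bsub>localization R S\<^esub> \<one>\<^bsub>localization R S\<^esub> \<otimes>\<^bsub>localization R S\<^esub> x"
        using subsetD[OF E_sub x] by (simp add: L.l_minus)
      then show ?thesis
        using closed[OF _ x] by simp
    qed
    show "x \<oplus>\<^bsub>localization R S\<^esub> y \<in> ?E" if xy: "x \<in> ?E" "y \<in> ?E" for x y
    proof -
      obtain a s b t where "x = fraction R S a s" "a \<in> P" "s \<in> S" "y = fraction R S b t" "b \<in> P" "t \<in> S"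
        using xy by blast
      then have "x \<oplus>\<^bsub>localization R S\<^esub> y = fraction R S (a \<otimes> t \<oplus> b \<otimes> s) (s \<otimes> t)"
        "a \<otimes> t \<oplus> b \<otimes> s \<in> P" "s \<otimes> t \<in> S"
        by (simp_all add: fraction_add P.I_r_closed S_mult)
      then show ?thesis
        by blast
    qed
    show "x \<otimes>\<^bsub>localization R S\<^esub> y \<in> ?E" "y \<otimes>\<^bsub>localization R S\<^esub> x \<in> ?E"
      if "y \<in> ?E" "x \<in> carrier (localization R S)" for x y
      using closed[OF that(2,1)] L.m_comm[OF that(2) subsetD[OF E_sub that(1)]] by argo+
  qed (rule E_sub)
  have sub: "to_localization R S ` P \<subseteq> carrier (localization R S)"
    using S_one by (auto simp: to_localization_def)
  show gen: "Idl\<^bsub>localization R S\<^esub> (to_localization R S ` P) = ?E"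
  proof
    show "Idl\<^bsub>localization R S\<^esub> (to_localization R S ` P) \<subseteq> ?E"
      using S_one by (intro L.genideal_minimal E) (auto simp: to_localization_def)
    show "?E \<subseteq> Idl\<^bsub>localization R S\<^esub> (to_localization R S ` P)"
      using fraction_mem_ideal_iff[OF L.genideal_ideal[OF sub]] L.genideal_self[OF sub] by auto
  qed
  show "primeideal (Idl\<^bsub>localization R S\<^esub> (to_localization R S ` P)) (localization R S)"
    unfolding gen
  proof (rule primeidealI[OF E L.cring_axioms])
    show "carrier (localization R S) \<noteq> ?E"
      \<comment> \<open>If \<open>1/1\<close> were in \<open>?E\<close>, then \<open>\<one>\<close>
        would lie in \<open>P\<close> as well as in \<open>S\<close>.\<close>
      using fraction_mem_primeideal[OF assms one_closed S_one] assms(2) S_one fraction_closed[OF one_closed S_one]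
      by blast
    show "x \<in> ?E \<or> y \<in> ?E"
      if x: "x \<in> carrier (localization R S)" and y: "y \<in> carrier (localization R S)"
        and xy: "x \<otimes>\<^bsub>localization R S\<^esub> y \<in> ?E" for x y
    proof -
      obtain a s where a: "x = fraction R S a s" "a \<in> carrier R" "s \<in> S"
        using x by (rule fractionE)
      obtain b t where b: "y = fraction R S b t" "b \<in> carrier R" "t \<in> S"
        using y by (rule fractionE)
      have "a \<otimes> b \<in> P"
        using xy fraction_mem_primeideal[OF assms, of "a \<otimes> b" "s \<otimes> t"] a b S_mult
        by (simp add: fraction_mult)
      then have "a \<in> P \<or> b \<in> P"
        using P.I_prime a b by blast
      then show ?thesis
        using a b by blast
    qed
  qed
qed

text \<open>This is the numerator test for \<open>P\<close> at denominator one.\<close>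

lemma contract_extend:
  assumes "primeideal P R" "P \<inter> S = {}"
  shows "{a \<in> carrier R. to_localization R S a \<in> Idl\<^bsub>localization R S\<^esub> (to_localization R S ` P)} = P"
  using fraction_mem_primeideal[OF assms _ S_one] ideal.Icarr[OF primeideal.axioms(1)[OF assms(1)]]
  unfolding genideal_image_primeideal(1)[OF assms] by (auto simp only: to_localization_def)

text \<open>Preimages of primes are prime. An \<open>s\<close> common to \<open>S\<close> and the
  preimage would put the unit \<open>s/1\<close>, hence \<open>s/s = 1\<close>, into
  \<open>Q\<close>.\<close>

lemma primeideal_contract:
  assumes "primeideal Q (localization R S)"
  shows "primeideal {a \<in> carrier R. to_localization R S a \<in> Q} R"
    and "{a \<in> carrier R. to_localization R S a \<in> Q} \<inter> S = {}"
proof -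
  interpret Q: primeideal Q "localization R S" by fact
  show "primeideal {a \<in> carrier R. to_localization R S a \<in> Q} R"
    using ring_hom_ring.primeideal_vimage[OF ring_hom_ring_to_localization is_cring assms] .
  have "\<one>\<^bsub>localization R S\<^esub> \<in> Q" if s: "s \<in> S" "to_localization R S s \<in> Q" for s
  proof -
    have "fraction R S s s = \<one>\<^bsub>localization R S\<^esub>"
      unfolding one_localization using s(1) S_one by (intro fraction_eqI) (simp_all add: m_comm)
    then show ?thesis
      using fraction_mem_ideal_iff[OF Q.is_ideal, of s s] s by auto
  qed
  then show "{a \<in> carrier R. to_localization R S a \<in> Q} \<inter> S = {}"
    using Q.one_imp_carrier Q.I_notcarr by blast
qed

text \<open>An element \<open>a/s\<close> lies in \<open>Q\<close> exactly when \<open>a/1\<close>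
  does, so \<open>Q\<close> consists of the fractions with numerator in its contraction, which is
  how the extended ideal was described.\<close>

lemma extend_contract:
  assumes "primeideal Q (localization R S)"
  shows "Idl\<^bsub>localization R S\<^esub> (to_localization R S ` {a \<in> carrier R. to_localization R S a \<in> Q}) = Q"
proof -
  interpret Q: primeideal Q "localization R S" by fact
  let ?P = "{a \<in> carrier R. to_localization R S a \<in> Q}"
  have "x \<in> Q \<longleftrightarrow> (\<exists>a s. x = fraction R S a s \<and> a \<in> ?P \<and> s \<in> S)" for x
  proof
    assume x: "x \<in> Q"
    then obtain a s where "x = fraction R S a s" "a \<in> carrier R" "s \<in> S"
      using Q.Icarr fractionE by blast
    with x show "\<exists>a s. x = fraction R S a s \<and> a \<in> ?P \<and> s \<in> S"
      using fraction_mem_ideal_iff[OF Q.is_ideal] by blast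
  next
    assume "\<exists>a s. x = fraction R S a s \<and> a \<in> ?P \<and> s \<in> S"
    then show "x \<in> Q"
      using fraction_mem_ideal_iff[OF Q.is_ideal] by blast
  qed
  then show ?thesis
    unfolding genideal_image_primeideal(1)[OF primeideal_contract[OF assms]] by blast
qed

end

section \<open>The spectrum of \<open>R_M\<close> as the set of primes below
  \<open>M\<close>\<close>

context cring
begin

lemma cring_local_ring: "M \<in> Spec R \<Longrightarrow> cring (local_ring R M)"
  by (simp add: Spec_def local_ring_def mult_subset.cring_localization mult_subset_compl_prime)

text \<open>Translates the disjointness hypothesis of the localization lemmas for
  \<open>S = carrier R - M\<close>.\<close>

lemma disjoint_compl_iff: "P \<in> Spec R \<Longrightarrow> P \<inter> (carrier R - M) = {} \<longleftrightarrow> P \<subseteq> M"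
  using ideal.Icarr[OF primeideal.axioms(1)] by (fastforce simp: Spec_def)

lemma spec_incl_extend_ideal:
  assumes "M \<in> Spec R" "P \<in> Spec R" "P \<subseteq> M"
  shows "spec_incl R M (extend_ideal R M P) = P"
  using mult_subset.contract_extend[OF mult_subset_compl_prime, of M R P] assms disjoint_compl_iff
  by (simp add: spec_incl_def extend_ideal_def local_ring_def to_local_ring_def Spec_def)

lemma extend_ideal_Spec:
  assumes "M \<in> Spec R" "P \<in> Spec R" "P \<subseteq> M"
  shows "extend_ideal R M P \<in> Spec (local_ring R M)"
  using mult_subset.genideal_image_primeideal(2)[OF mult_subset_compl_prime, of M R P] assms disjoint_compl_iff
  by (simp add: extend_ideal_def local_ring_def to_local_ring_def Spec_def)

lemma spec_incl_Spec:
  assumes "M \<in> Spec R" "Q \<in> Spec (local_ring R M)"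
  shows "spec_incl R M Q \<in> Spec R" "spec_incl R M Q \<subseteq> M"
  using mult_subset.primeideal_contract[OF mult_subset_compl_prime, of M R Q] assms
  by (auto simp add: spec_incl_def local_ring_def to_local_ring_def Spec_def)

lemma extend_ideal_spec_incl:
  assumes "M \<in> Spec R" "Q \<in> Spec (local_ring R M)"
  shows "extend_ideal R M (spec_incl R M Q) = Q"
  using mult_subset.extend_contract[OF mult_subset_compl_prime, of M R Q] assms
  by (simp add: spec_incl_def extend_ideal_def local_ring_def to_local_ring_def Spec_def)

section \<open>Localizing and gluing Thomason subsets\<close>

text \<open>Contraction and extension are mutually inverse, so the image of \<open>X\<close> under
  extension becomes a preimage under contraction, where membership can be tested on \<open>Q\<close>
  itself.\<close>

lemma localize_subset_eq:
  assumes "M \<in> mSpec R" "X \<subseteq> Spec R"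
  shows "localize_subset R X M = {Q \<in> Spec (local_ring R M). spec_incl R M Q \<in> X}"
proof -
  have M: "M \<in> Spec R"
    using assms(1) mSpec_subset_Spec by blast
  have "\<exists>P. Q = extend_ideal R M P \<and> P \<in> X \<and> P \<subseteq> M"
    if "Q \<in> Spec (local_ring R M)" "spec_incl R M Q \<in> X" for Q
    using that extend_ideal_spec_incl[OF M] spec_incl_Spec[OF M] by metis
  moreover have "extend_ideal R M P \<in> Spec (local_ring R M)" "spec_incl R M (extend_ideal R M P) \<in> X"
    if "P \<in> X" "P \<subseteq> M" for P
    using that assms(2) M by (auto simp: extend_ideal_Spec spec_incl_extend_ideal subsetD)
  ultimately show ?thesis
    using assms(1) unfolding localize_subset_def by auto
qed

lemma star_localize_subset:
  assumes "M \<in> mSpec R" "X \<subseteq> Spec R"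
  shows "star R M (localize_subset R X M) = {P \<in> X. P \<subseteq> M}"
proof -
  have "spec_incl R M (extend_ideal R M P) = P" if "P \<in> X" "P \<subseteq> M" for P
    using that assms mSpec_subset_Spec by (intro spec_incl_extend_ideal) auto
  then show ?thesis
    using assms(1) unfolding star_def localize_subset_def by force
qed

text \<open>A finite set \<open>A\<close> lies in the contraction of \<open>Q\<close> exactly when
  its image lies in \<open>Q\<close>. The images of the finite sets describing \<open>X\<close> thus
  describe the localized subset.\<close>

lemma thomason_localize_subset:
  assumes "M \<in> mSpec R" "thomason_subset R X"
  shows "thomason_subset (local_ring R M) (localize_subset R X M)"
proof -
  have M: "M \<in> Spec R"
    using assms(1) mSpec_subset_Spec by blast
  interpret L: cring "local_ring R M"
    by (rule cring_local_ring[OF M])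
  interpret S: mult_subset R "carrier R - M"
    using M by (simp add: Spec_def mult_subset_compl_prime)
  from assms(2) obtain \<A> where A: "\<And>A. A \<in> \<A> \<Longrightarrow> finite A \<and> A \<subseteq> carrier R"
    and X: "X = {P \<in> Spec R. \<exists>A\<in>\<A>. A \<subseteq> P}"
    unfolding thomason_subset_iff by blast
  have "A \<subseteq> spec_incl R M Q \<longleftrightarrow> to_local_ring R M ` A \<subseteq> Q" if "A \<in> \<A>" for A Q
    using A[OF that] by (auto simp: spec_incl_def)
  then have "(\<exists>A\<in>\<A>. A \<subseteq> spec_incl R M Q) \<longleftrightarrow> (\<exists>B\<in>(`) (to_local_ring R M) ` \<A>. B \<subseteq> Q)" for Q
    by simp
  moreover have "localize_subset R X M =
      {Q \<in> Spec (local_ring R M). \<exists>A\<in>\<A>. A \<subseteq> spec_incl R M Q}"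
    \<comment> \<open>The requirement in \<open>X\<close> that the contraction be prime holds
      automatically and drops out.\<close>
    using localize_subset_eq[OF assms(1) thomason_subset_Spec[OF assms(2)]]
      spec_incl_Spec(1)[OF M] by (simp add: X cong: conj_cong)
  ultimately have "localize_subset R X M =
      {Q \<in> Spec (local_ring R M). \<exists>B\<in>(`) (to_local_ring R M) ` \<A>. B \<subseteq> Q}"
    by simp
  moreover have "finite (to_local_ring R M ` A) \<and> to_local_ring R M ` A \<subseteq> carrier (local_ring R M)"
    if "A \<in> \<A>" for A
    using A[OF that] ring_hom_closed[OF S.to_localization_hom]
    by (auto simp: local_ring_def to_local_ring_def)
  ultimately show ?thesis
    unfolding L.thomason_subset_iff by (intro exI[of _ "(`) (to_local_ring R M) ` \<A>"]) simp
qed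

lemma glue_localize_subset:
  assumes "thomason_subset R X"
  shows "glue R (localize_subset R X) = X"
proof -
  have X: "X \<subseteq> Spec R"
    using assms by (rule thomason_subset_Spec)
  then have "glue R (localize_subset R X) = (\<Union>M\<in>mSpec R. {P \<in> X. P \<subseteq> M})"
    by (simp add: glue_def star_localize_subset)
  also have "\<dots> = X"
  proof -
    have "\<exists>M\<in>mSpec R. P \<subseteq> M" if "P \<in> X" for P
      using Spec_below_mSpec[OF subsetD[OF X that]] by blast
    then show ?thesis
      by auto
  qed
  finally show ?thesis .
qed

text \<open>In condition (1) both sides are the primes of \<open>X\<close> below \<open>M\<close>
  and \<open>M'\<close>; in condition (2) the union is \<open>X\<close> again.\<close>

lemma localize_subset_compatible:
  assumes "thomason_subset R X"
  shows "localize_subset R X \<in> compatible_families R"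
proof -
  have "compatible R (localize_subset R X)"
    using star_localize_subset[OF _ thomason_subset_Spec[OF assms]]
      glue_localize_subset[OF assms] assms
    by (auto simp: compatible_def glue_def)
  then show ?thesis
    using thomason_localize_subset[OF _ assms]
    by (auto simp: compatible_families_def PiE_iff localize_subset_def)
qed

lemma glue_thomason: "F \<in> compatible_families R \<Longrightarrow> thomason_subset R (glue R F)"
  by (simp add: compatible_families_def compatible_def glue_def)

lemma localize_subset_glue:
  assumes "F \<in> compatible_families R"
  shows "localize_subset R (glue R F) = F"
proof (rule extensionalityI)
  have F: "\<And>M. M \<in> mSpec R \<Longrightarrow> thomason_subset (local_ring R M) (F M)"
    and compat: "\<And>M M'. \<lbrakk>M \<in> mSpec R; M' \<in> mSpec R\<rbrakk> \<Longrightarrow>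
      {P \<in> star R M (F M). P \<subseteq> M'} = {P \<in> star R M' (F M'). P \<subseteq> M}"
    using assms by (auto simp: compatible_families_def compatible_def)
  show "localize_subset R (glue R F) \<in> extensional (mSpec R)" "F \<in> extensional (mSpec R)"
    using assms by (auto simp: localize_subset_def compatible_families_def PiE_iff)
  fix M assume M: "M \<in> mSpec R"
  then have M': "M \<in> Spec R"
    using mSpec_subset_Spec by blast
  have FM: "F M \<subseteq> Spec (local_ring R M)"
    using F[OF M] by (rule thomason_subset_Spec)
  have "Q \<in> F M" if Q: "Q \<in> Spec (local_ring R M)" "spec_incl R M Q \<in> glue R F" for Q
  proof -
    obtain N where N: "N \<in> mSpec R" "spec_incl R M Q \<in> star R N (F N)"
      using Q(2) by (auto simp: glue_def)
    have "spec_incl R M Q \<subseteq> M"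
      by (rule spec_incl_Spec(2)[OF M' Q(1)])
    then have "spec_incl R M Q \<in> star R M (F M)"
      \<comment> \<open>Being below \<open>M\<close>, the contraction is in the right side of
        condition (1) for \<open>M\<close> and \<open>N\<close>, hence in the left.\<close>
      using compat[OF M N(1)] N(2) by blast
    then obtain Q' where "Q' \<in> F M" "spec_incl R M Q = spec_incl R M Q'"
      by (auto simp: star_def)
    then show ?thesis
      \<comment> \<open>Extending both contractions back to \<open>R_M\<close> gives
        \<open>Q = Q'\<close>.\<close>
      using extend_ideal_spec_incl[OF M'] Q(1) FM by (metis subsetD)
  qed
  then show "localize_subset R (glue R F) M = F M"
    using localize_subset_eq[OF M thomason_subset_Spec[OF glue_thomason[OF assms]]] FM M
    by (auto simp: glue_def star_def)
qed

section \<open>Thomason filtrations, degree by degree\<close>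

lemma localize_filtration_apply:
  "M \<in> mSpec R \<Longrightarrow> localize_filtration R X M n = localize_subset R (X n) M"
  by (simp add: localize_filtration_def)

lemma glue_cong:
  assumes "\<And>M. M \<in> mSpec R \<Longrightarrow> F M = G M"
  shows "glue R F = glue R G"
  using assms by (simp add: glue_def)

lemma compatible_cong:
  assumes "\<And>M. M \<in> mSpec R \<Longrightarrow> F M = G M"
  shows "compatible R F \<longleftrightarrow> compatible R G"
  using assms by (simp add: compatible_def)

text \<open>Reduces each degree to the case of subsets. The explicit restriction to
  \<open>mSpec R\<close> is there because outside it \<open>F M n\<close> is
  \<open>undefined n\<close>, which is not known to be \<open>undefined\<close>.\<close>

lemma filtration_family_degree:
  assumes "F \<in> compatible_filtration_families R"
  shows "(\<lambda>M\<in>mSpec R. F M n) \<in> compatible_families R"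
proof -
  have "compatible R (\<lambda>M\<in>mSpec R. F M n)"
    using assms compatible_cong[of "\<lambda>M\<in>mSpec R. F M n" "\<lambda>M. F M n"]
    by (simp add: compatible_filtration_families_def)
  then show ?thesis
    using assms
    by (auto simp: compatible_families_def compatible_filtration_families_def thomason_filtration_def PiE_iff)
qed

text \<open>Gluing reads a family only on \<open>mSpec R\<close>, so the restricted families of
  \<open>filtration_family_degree\<close> may be inserted.\<close>

lemma glue_filtration_apply: "glue_filtration R F n = glue R (\<lambda>M\<in>mSpec R. F M n)"
  by (simp add: glue_filtration_def glue_def)

lemma glue_localize_filtration:
  assumes "thomason_filtration R X"
  shows "glue_filtration R (localize_filtration R X) = X"
proof
  fix n
  have "glue_filtration R (localize_filtration R X) n = glue R (localize_subset R (X n))"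
    unfolding glue_filtration_def by (intro glue_cong) (simp add: localize_filtration_apply)
  then show "glue_filtration R (localize_filtration R X) n = X n"
    using assms by (simp add: glue_localize_subset thomason_filtration_def)
qed

lemma localize_filtration_compatible:
  assumes "thomason_filtration R X"
  shows "localize_filtration R X \<in> compatible_filtration_families R"
proof -
  have X: "thomason_subset R (X n)" "X (n + 1) \<subseteq> X n" for n
    using assms by (simp_all add: thomason_filtration_def)
  have "compatible R (\<lambda>M. localize_filtration R X M n)" for n
    using localize_subset_compatible[OF X(1)[of n]]
      compatible_cong[of "\<lambda>M. localize_filtration R X M n" "localize_subset R (X n)"]
    by (simp add: compatible_families_def localize_filtration_apply)
  moreover have "thomason_filtration (local_ring R M) (localize_filtration R X M)"
    if M: "M \<in> mSpec R" for M
    \<comment> \<open>The inclusions between degrees persist because \<open>localize_subset\<close>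
      is monotone in the subset.\<close>
    unfolding thomason_filtration_def localize_filtration_apply[OF M]
    using thomason_localize_subset[OF M X(1)] X(2) M by (fastforce simp: localize_subset_def)
  ultimately show ?thesis
    by (auto simp: compatible_filtration_families_def PiE_iff localize_filtration_def)
qed

lemma glue_filtration_thomason:
  assumes "F \<in> compatible_filtration_families R"
  shows "thomason_filtration R (glue_filtration R F)"
proof -
  have "thomason_subset R (glue_filtration R F n)" for n
    unfolding glue_filtration_apply by (intro glue_thomason filtration_family_degree assms)
  moreover have "F M (n + 1) \<subseteq> F M n" if "M \<in> mSpec R" for M n
    using assms that by (auto simp: compatible_filtration_families_def thomason_filtration_def PiE_iff)
  \<comment> \<open>Images and unions are monotone, so inclusions at every \<open>M\<close> pass to
    the glued sets.\<close>
  then have "glue_filtration R F (n + 1) \<subseteq> glue_filtration R F n" for n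
    unfolding glue_filtration_def glue_def star_def by fast
  ultimately show ?thesis
    by (simp add: thomason_filtration_def)
qed

lemma localize_filtration_glue:
  assumes "F \<in> compatible_filtration_families R"
  shows "localize_filtration R (glue_filtration R F) = F"
proof (rule extensionalityI)
  show "localize_filtration R (glue_filtration R F) \<in> extensional (mSpec R)"
    "F \<in> extensional (mSpec R)"
    using assms by (auto simp: localize_filtration_def compatible_filtration_families_def PiE_iff)
  fix M assume M: "M \<in> mSpec R"
  show "localize_filtration R (glue_filtration R F) M = F M"
  proof
    fix n
    show "localize_filtration R (glue_filtration R F) M n = F M n"
      using localize_subset_glue[OF filtration_family_degree[OF assms, of n]] M
      by (simp add: localize_filtration_apply glue_filtration_apply)
  qed
qed

end

theorem proposition3p11:
  fixes R :: "('a, 'b) ring_scheme" (structure)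
  assumes "cring R"
  shows "(bij_betw (localize_subset R) {X. thomason_subset R X} (compatible_families R) \<and>
          bij_betw (glue R) (compatible_families R) {X. thomason_subset R X} \<and>
          (\<forall>X. thomason_subset R X \<longrightarrow> glue R (localize_subset R X) = X) \<and>
          (\<forall>F\<in>compatible_families R. localize_subset R (glue R F) = F)) \<and>
         (bij_betw (localize_filtration R) {X. thomason_filtration R X}
            (compatible_filtration_families R) \<and>
          bij_betw (glue_filtration R) (compatible_filtration_families R)
            {X. thomason_filtration R X} \<and>
          (\<forall>X. thomason_filtration R X \<longrightarrow> glue_filtration R (localize_filtration R X) = X) \<and>
          (\<forall>F\<in>compatible_filtration_families R.
             localize_filtration R (glue_filtration R F) = F))"
proof -
  interpret cring R by fact
  show ?thesis
    \<comment> \<open>Each of the four maps is bijective with its partner as witness: two inverse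
      laws and two statements that the maps land in the right sets.\<close>
    using glue_localize_subset localize_subset_glue localize_subset_compatible glue_thomason
      glue_localize_filtration localize_filtration_glue localize_filtration_compatible
      glue_filtration_thomason
    by (intro conjI) (auto intro!: bij_betw_byWitness[where f' = "glue R"]
        bij_betw_byWitness[where f' = "localize_subset R"]
        bij_betw_byWitness[where f' = "glue_filtration R"]
        bij_betw_byWitness[where f' = "localize_filtration R"])
qed

end
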